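(* Let $\Gamma=\mathrm{SC}(G,R,R,S)$ be a semi-Cayley graph over a finite abelian group $G$ of order $n$, and let $\alpha,\beta$ be nonzero complex numbers. If $(\alpha,\beta)$-revival occurs on $\Gamma$ from a vertex $u$ to a vertex $v$, then $\Gamma$ is an integral graph (all eigenvalues of its adjacency matrix are integers). Moreover, for every $z\in G$, $\chi_z(R)$ and $|\chi_z(S)|$ are integers.
   Context: $G$ is a finite abelian group of order $n$, written multiplicatively with identity $1$, identified with $\mathbb{Z}_{n_1}\otimes\cdots\otimes\mathbb{Z}_{n_r}$. For $z=(z_1,\dots,z_r)$, $g=(g_1,\dots,g_r)$ in $G$, $\chi_z(g)=\prod_{s=1}^r\omega_{n_s}^{z_sg_s}$ with $\omega_m=\exp(2\pi\imath/m)$. For $Y\subseteq G$, $\chi_z(Y)=\sum_{y\in Y}\chi_z(y)$. $R,S\subseteq G$ with $R=R^{-1}$, $1\notin R$. The semi-Cayley graph $\mathrm{SC}(G,R,R,S)$ has vertex set $\{(g,0),(g,1):g\in G\}$ and edges $\{(g,0),(h,0)\}$ and $\{(g,1),(h,1)\}$ for $hg^{-1}\in R$, and $\{(g,0),(h,1)\}$ for $hg^{-1}\in S$. The transition matrix is $H(t)=\exp(\imath tA)$, $A$ the adjacency matrix. For distinct vertices $u,v$, $(\alpha,\beta)$-revival occurs from $u$ to $v$ (at some time $t$) if $H(t)\mathbf{e}_u=\alpha\mathbf{e}_u+\beta\mathbf{e}_v$ with $|\alpha|^2+|\beta|^2=1$. *)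

theory Defs
  imports "HOL-Analysis.Analysis"
begin

text \<open>
  The finite abelian group is a type of class \<open>ab_group_add\<close> and \<open>finite\<close>, so it is written
  additively: the identity is \<open>0\<close>, and \<open>h g\<^sup>-\<^sup>1\<close> becomes \<open>h - g\<close>.
\<close>

subsection \<open>Characters\<close>

text \<open>
  The identification of the group with the product of the cyclic groups of orders
  \<open>N 0, \<dots>, N (r - 1)\<close>, given by a coordinate map \<open>c\<close>. Elements of the product are extensional
  functions on \<open>{..<r}\<close> whose value at \<open>s\<close> is a residue below \<open>N s\<close>.
\<close>

definition cyclic_coordinates ::
    "nat \<Rightarrow> (nat \<Rightarrow> nat) \<Rightarrow> ('g::ab_group_add \<Rightarrow> nat \<Rightarrow> nat) \<Rightarrow> bool" where
  "cyclic_coordinates r N c \<longleftrightarrow>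
     (\<forall>s<r. N s > 0) \<and>
     bij_betw c UNIV (PiE {..<r} (\<lambda>s. {..<N s})) \<and>
     (\<forall>g h. \<forall>s<r. c (g + h) s = (c g s + c h s) mod N s)"

definition root_unity :: "nat \<Rightarrow> complex" where
  "root_unity m = exp (2 * of_real pi * \<i> / of_nat m)"

definition chi ::
    "nat \<Rightarrow> (nat \<Rightarrow> nat) \<Rightarrow> ('g \<Rightarrow> nat \<Rightarrow> nat) \<Rightarrow> 'g \<Rightarrow> 'g \<Rightarrow> complex" where
  "chi r N c z g = (\<Prod>s<r. root_unity (N s) ^ (c z s * c g s))"

definition chi_set ::
    "nat \<Rightarrow> (nat \<Rightarrow> nat) \<Rightarrow> ('g \<Rightarrow> nat \<Rightarrow> nat) \<Rightarrow> 'g \<Rightarrow> 'g set \<Rightarrow> complex" where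
  "chi_set r N c z Y = (\<Sum>y\<in>Y. chi r N c z y)"

subsection \<open>Graphs and their spectra\<close>

text \<open>
  A graph on the vertex type \<open>'v\<close> is given by its set of edges, each an unordered pair.
\<close>

definition adjacency_matrix :: "'v set set \<Rightarrow> complex^'v^'v" where
  "adjacency_matrix E = (\<chi> u v. if {u, v} \<in> E then 1 else 0)"

definition matrix_eigenvalue :: "complex^'v^'v \<Rightarrow> complex \<Rightarrow> bool" where
  "matrix_eigenvalue A \<mu> \<longleftrightarrow> (\<exists>x. x \<noteq> 0 \<and> A *v x = \<mu> *s x)"

definition integral_graph :: "('v::finite) set set \<Rightarrow> bool" where
  "integral_graph E \<longleftrightarrow> (\<forall>\<mu>. matrix_eigenvalue (adjacency_matrix E) \<mu> \<longrightarrow> \<mu> \<in> \<int>)"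

text \<open>The second component of a vertex lies in the two-element type \<open>2\<close>, with elements 0 and 1.\<close>

definition semi_cayley :: "('g::ab_group_add) set \<Rightarrow> 'g set \<Rightarrow> 'g set \<Rightarrow> ('g \<times> 2) set set" where
  "semi_cayley R L S =
     {{(g, 0), (h, 0)} | g h. h - g \<in> R} \<union>
     {{(g, 1), (h, 1)} | g h. h - g \<in> L} \<union>
     {{(g, 0), (h, 1)} | g h. h - g \<in> S}"

subsection \<open>Transition matrix and revival\<close>

text \<open>
  The power series is spelled out because the multiplication of the type \<open>complex^'v^'v\<close> is
  componentwise; the matrix product is \<open>(**)\<close>.
\<close>

definition matrix_exp :: "complex^'v^'v \<Rightarrow> complex^'v^'v" where
  "matrix_exp A = (\<Sum>k. (1 / fact k) *\<^sub>R (((**) A ^^ k) (mat 1)))"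

definition transition_matrix :: "('v::finite) set set \<Rightarrow> real \<Rightarrow> complex^'v^'v" where
  "transition_matrix E t = matrix_exp (\<chi> u v. \<i> * of_real t * adjacency_matrix E $ u $ v)"

definition revival :: "('v::finite) set set \<Rightarrow> complex \<Rightarrow> complex \<Rightarrow> 'v \<Rightarrow> 'v \<Rightarrow> bool" where
  "revival E \<alpha> \<beta> u v \<longleftrightarrow>
     u \<noteq> v \<and> (norm \<alpha>)\<^sup>2 + (norm \<beta>)\<^sup>2 = 1 \<and>
     (\<exists>t. transition_matrix E t *v axis u 1 = \<alpha> *s axis u 1 + \<beta> *s axis v 1)"

end

theory Submission
  imports Defs "HOL-Number_Theory.Cong"
begin

text \<open>
  Write \<open>\<chi>\<^sub>z(S) = s\<^sub>z \<phi>\<^sub>z\<close> with \<open>s\<^sub>z = \<bar>\<chi>\<^sub>z(S)\<bar>\<close> and \<open>\<bar>\<phi>\<^sub>z\<bar> = 1\<close>. The adjacency matrix has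
  eigenvectors \<open>(\<phi>\<^sub>z \<chi>\<^sub>z, e \<chi>\<^sub>z)\<close> with eigenvalues \<open>\<chi>\<^sub>z(R) + e s\<^sub>z\<close>, \<open>e = \<plusminus>1\<close>. Pairing each
  eigenvector with the revival equation expresses \<open>exp (\<i> t (\<chi>\<^sub>z(R) + e s\<^sub>z))\<close> as \<open>\<alpha> + \<beta> x\<close> with
  \<open>\<bar>x\<bar> = 1\<close>; as this has modulus 1 and \<open>x = 1\<close> for \<open>z = 0\<close>, \<open>e = 1\<close>, always \<open>x = \<plusminus>1\<close>. So, up to
  a sign, \<open>\<chi>\<^sub>z(R)\<close> and \<open>s\<^sub>z\<close> move by multiples of \<open>\<pi> / t\<close> when \<open>z\<close> varies in a class of
  characters whose character sums are known by orthogonality. If \<open>\<pi> / t\<close> is rational, all values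
  are therefore rational; otherwise the sums leave at most two elements in the set, and its
  character values are clearly rational. Finally, a rational eigenvalue of an integer matrix is an integer.
\<close>

section \<open>Rational eigenvalues of integer matrices\<close>

lemma det_of_int_complex:
  fixes D :: "int^'n^'n"
  shows "det ((\<chi> i j. of_int (D $ i $ j)) :: complex^'n^'n) = of_int (det D)"
  by (simp add: det_def)

text \<open>For \<mu> = p / q in lowest terms, the integer matrix \<open>p I - q A\<close> is
  singular. Modulo q its determinant is that of \<open>p I\<close>, a power of p, so q divides a
  power of p and must be 1.\<close>

lemma rational_eigenvalue_integer_matrix:
  fixes A :: "complex^'n^'n"
  assumes ints: "\<And>i j. A $ i $ j \<in> \<int>"
    and eig: "A *v x = \<mu> *s x" and "x \<noteq> 0" and "\<mu> \<in> \<rat>"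
  shows "\<mu> \<in> \<int>"
proof -
  from \<open>\<mu> \<in> \<rat>\<close> obtain p q :: int where q: "q > 0" "coprime p q" "\<mu> = of_int p / of_int q"
    by (rule Rats_cases')
  from ints have "\<forall>i j. \<exists>a::int. A $ i $ j = of_int a"
    by (auto elim!: Ints_cases)
  then obtain a :: "'n \<Rightarrow> 'n \<Rightarrow> int" where a: "\<And>i j. A $ i $ j = of_int (a i j)"
    by metis
  define D :: "int^'n^'n" where "D = (\<chi> i j. (if i = j then p else 0) - q * a i j)"
  define D' :: "complex^'n^'n" where "D' = (\<chi> i j. of_int (D $ i $ j))"
  have "(D' *v x) $ i = 0" for i
  proof -
    have "(D' *v x) $ i = (\<Sum>j\<in>UNIV. (if i = j then of_int p * x $ j else 0)) - of_int q * (A *v x) $ i"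
      unfolding sum_distrib_left sum_subtractf[symmetric] matrix_vector_mult_def vec_lambda_beta
      by (intro sum.cong) (auto simp: D'_def D_def a algebra_simps)
    also have "\<dots> = 0"
      using q by (simp add: eig)
    finally show ?thesis .
  qed
  then have "D' *v x = 0"
    by (simp add: vec_eq_iff)
  with \<open>x \<noteq> 0\<close> have "det D' = 0"
    by (metis invertible_det_nz invertible_left_inverse matrix_left_invertible_ker)
  then have "det D = 0"
    by (simp add: D'_def det_of_int_complex)
  moreover have "[det D = det ((\<chi> i j. if i = j then p else 0) :: int^'n^'n)] (mod q)"
    unfolding det_def
    by (intro cong_sum cong_mult cong_prod cong_refl) (auto simp: D_def cong_iff_dvd_diff)
  moreover have "det ((\<chi> i j. if i = j then p else 0) :: int^'n^'n) = p ^ CARD('n)"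
    by (subst det_diagonal) auto
  ultimately have "q dvd p ^ CARD('n)"
    by (simp add: cong_iff_dvd_diff)
  moreover have "coprime (p ^ CARD('n)) q"
    using q by simp
  ultimately have "is_unit q"
    by (metis coprime_absorb_right)
  with q have "q = 1"
    by simp
  with q show ?thesis by simp
qed

section \<open>The matrix exponential and its action on eigenvectors\<close>

text \<open>Left multiplication by \<open>A\<close> is a bounded linear map. With a bound
  \<open>K\<close> for it, the series is dominated by a multiple of the exponential series of
  \<open>K\<close>.\<close>

lemma summable_matrix_exp:
  fixes A :: "complex^'n^'n"
  shows "summable (\<lambda>k. (1 / fact k) *\<^sub>R (((**) A ^^ k) (mat 1)))"
proof -
  have "linear (\<lambda>M :: complex^'n^'n. A ** M)"
    by (rule linearI) (simp_all add: matrix_add_ldistrib, simp add: vec_eq_iff matrix_matrix_mult_def scaleR_sum_right)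
  then obtain K where K: "K > 0" "\<And>M :: complex^'n^'n. norm (A ** M) \<le> K * norm M"
    by (rule linear_bounded_pos) blast
  have bound: "norm (((**) A ^^ k) (mat 1)) \<le> K ^ k * norm (mat 1 :: complex^'n^'n)" for k
  proof (induction k)
    case (Suc k)
    have "norm (((**) A ^^ Suc k) (mat 1)) \<le> K * norm (((**) A ^^ k) (mat 1))"
      using K(2)[of "((**) A ^^ k) (mat 1)"] by simp
    also have "\<dots> \<le> K * (K ^ k * norm (mat 1 :: complex^'n^'n))"
      using K(1) Suc by simp
    also have "\<dots> = K ^ Suc k * norm (mat 1 :: complex^'n^'n)"
      by simp
    finally show ?case .
  qed simp
  have "summable (\<lambda>k. (K ^ k /\<^sub>R fact k) * norm (mat 1 :: complex^'n^'n))"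
    by (rule summable_mult2) (rule summable_exp_generic)
  then show ?thesis
  proof (rule summable_comparison_test[rotated], intro exI allI impI)
    fix k
    show "norm ((1 / fact k) *\<^sub>R (((**) A ^^ k) (mat 1)))
        \<le> (K ^ k /\<^sub>R fact k) * norm (mat 1 :: complex^'n^'n)"
      using mult_left_mono[OF bound[of k], of "1 / fact k"] by (simp add: divide_inverse mult.assoc)
  qed
qed

text \<open>Multiplying by \<open>w\<close> from the left is linear and continuous, so it passes
  through the series and turns the k-th power of \<open>A\<close> into
  \<open>\<mu> ^ k *s w\<close>.\<close>

lemma matrix_exp_left_eigenvector:
  fixes A :: "complex^'n^'n"
  assumes "w v* A = \<mu> *s w"
  shows "w v* matrix_exp A = exp \<mu> *s w"
proof -
  let ?P = "\<lambda>k. ((**) A ^^ k) (mat 1)"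
  have "linear (\<lambda>M. w v* (M :: complex^'n^'n))"
    by (rule linearI) (simp_all add: vec_eq_iff vector_matrix_mult_def algebra_simps sum.distrib scaleR_sum_right)
  then interpret L: bounded_linear "\<lambda>M. w v* (M :: complex^'n^'n)"
    by (simp add: linear_conv_bounded_linear)
  have "linear (\<lambda>a::complex. a *s w)"
    by (rule linearI) (simp_all add: vec_eq_iff algebra_simps)
  then interpret S: bounded_linear "\<lambda>a::complex. a *s w"
    by (simp add: linear_conv_bounded_linear)
  have pow: "w v* ?P k = \<mu> ^ k *s w" for k
  proof (induction k)
    case (Suc k)
    have "w v* ?P (Suc k) = (w v* A) v* ?P k"
      by (simp add: vector_matrix_mul_assoc)
    also have "\<dots> = \<mu> *s (w v* ?P k)"
      unfolding assms by (simp add: scalar_vector_matrix_assoc)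
    finally show ?case
      by (simp add: Suc)
  qed simp
  have "(\<lambda>k. w v* ((1 / fact k) *\<^sub>R ?P k)) sums (w v* matrix_exp A)"
    unfolding matrix_exp_def by (rule L.sums) (rule summable_sums[OF summable_matrix_exp])
  moreover have "w v* ((1 / fact k) *\<^sub>R ?P k) = (\<mu> ^ k /\<^sub>R fact k) *s w" for k
    by (simp add: L.scaleR pow S.scaleR divide_inverse)
  moreover have "(\<lambda>k. (\<mu> ^ k /\<^sub>R fact k) *s w) sums (exp \<mu> *s w)"
    by (rule S.sums) (rule exp_converges)
  ultimately show ?thesis
    by (simp add: sums_unique2)
qed

lemma sum_vector_matrix_mult:
  "(\<Sum>i\<in>UNIV. w $ i * (M *v x) $ i) = (\<Sum>j\<in>UNIV. (w v* M) $ j * (x::complex^'n) $ j)"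
  unfolding matrix_vector_mult_def vector_matrix_mult_def
  by (simp add: sum_distrib_left sum_distrib_right, subst sum.swap) (simp add: mult_ac)

lemma adjacency_matrix_left:
  "w v* adjacency_matrix E = adjacency_matrix E *v w"
  unfolding vec_eq_iff adjacency_matrix_def vector_matrix_mult_def matrix_vector_mult_def
  by (auto simp: insert_commute intro!: sum.cong)

text \<open>The adjacency matrix is symmetric, so \<open>w\<close> is also a left eigenvector.
  Pairing it with both sides of the revival equation, bilinearly and without conjugation, leaves
  only its entries at \<open>u\<close> and \<open>v\<close>.\<close>

lemma eigenvector_at_revival:
  fixes E :: "('v::finite) set set"
  assumes eig: "adjacency_matrix E *v w = \<mu> *s w"
    and rev: "transition_matrix E t *v axis u 1 = \<alpha> *s axis u 1 + \<beta> *s axis v 1"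
  shows "exp (\<i> * of_real t * \<mu>) * w $ u = \<alpha> * w $ u + \<beta> * w $ v"
proof -
  let ?A = "adjacency_matrix E"
  have "w v* (\<chi> u v. \<i> * of_real t * ?A $ u $ v) = (\<i> * of_real t) *s (w v* ?A)"
    by (simp add: vec_eq_iff vector_matrix_mult_def sum_distrib_left mult_ac)
  also have "\<dots> = (\<i> * of_real t * \<mu>) *s w"
    by (simp add: adjacency_matrix_left eig)
  finally have left: "w v* transition_matrix E t = exp (\<i> * of_real t * \<mu>) *s w"
    unfolding transition_matrix_def by (rule matrix_exp_left_eigenvector)
  have ax: "(\<Sum>i\<in>UNIV. f i * axis k (1::complex) $ i) = f k" for f and k :: 'v
    by (simp add: axis_def if_distrib cong: if_cong)
  have "exp (\<i> * of_real t * \<mu>) * w $ u = (\<Sum>i\<in>UNIV. w $ i * (transition_matrix E t *v axis u 1) $ i)"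
    by (simp only: sum_vector_matrix_mult left ax) simp
  also have "\<dots> = (\<Sum>i\<in>UNIV. \<alpha> * w $ i * axis u 1 $ i) + (\<Sum>i\<in>UNIV. \<beta> * w $ i * axis v 1 $ i)"
    unfolding rev sum.distrib[symmetric] by (intro sum.cong) (auto simp: algebra_simps)
  also have "\<dots> = \<alpha> * w $ u + \<beta> * w $ v"
    by (simp only: ax)
  finally show ?thesis .
qed

section \<open>Complex numbers of modulus 1\<close>

text \<open>For y of modulus 1, \<alpha> + \<beta> y has modulus 1 exactly when
  \<open>cnj \<alpha> * \<beta> * y\<close> is purely imaginary. Applied to y = 1 and y = x, this
  makes x a quotient of imaginary numbers, hence real.\<close>

lemma unit_combination_cases:
  fixes \<alpha> \<beta> x :: complex
  assumes "\<alpha> \<noteq> 0" "\<beta> \<noteq> 0" and ab: "(norm \<alpha>)\<^sup>2 + (norm \<beta>)\<^sup>2 = 1"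
    and one: "norm (\<alpha> + \<beta>) = 1" and x: "norm (\<alpha> + \<beta> * x) = 1" "norm x = 1"
  shows "x = 1 \<or> x = -1"
proof -
  define w where "w = cnj \<alpha> * \<beta>"
  have expand: "(norm (\<alpha> + \<beta> * y))\<^sup>2 = (norm \<alpha>)\<^sup>2 + (norm \<beta>)\<^sup>2 * (norm y)\<^sup>2 + 2 * Re (w * y)" for y
    unfolding w_def norm_mult cmod_power2 by (simp add: power2_eq_square algebra_simps)
  have "Re w = 0" "Re (w * x) = 0"
    using expand[of 1] expand[of x] ab one x by simp_all
  moreover have "w \<noteq> 0"
    using assms by (simp add: w_def)
  ultimately have "Im x = 0"
    by (auto simp: complex_eq_iff)
  with x(2) have "\<bar>Re x\<bar> = 1"
    by (simp add: cmod_def)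
  with \<open>Im x = 0\<close> show ?thesis
    by (auto simp: complex_eq_iff abs_if split: if_splits)
qed

text \<open>The factor 2 stays outside so that halving sums and differences of such relations still
  leaves integer multiples of \<open>pi / t\<close>.\<close>

lemma exp_imaginary_eq:
  fixes t a b :: real
  assumes "exp (\<i> * of_real t * of_real a) = exp (\<i> * of_real t * of_real b)" "t \<noteq> 0"
  shows "\<exists>k::int. a - b = 2 * (pi / t * of_int k)"
proof -
  from assms(1) obtain k :: int where "\<i> * of_real t * of_real a = \<i> * of_real t * of_real b + of_int (2 * k) * pi * \<i>"
    unfolding exp_eq by auto
  then have "t * a = t * b + 2 * k * pi"
    by (simp add: complex_eq_iff)
  with assms(2) have "a - b = 2 * (pi / t * of_int k)"
    by (simp add: field_simps)
  then show ?thesis ..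
qed

section \<open>Roots of unity and the characters of the group\<close>

lemma root_unity_power_eq_1: "n > 0 \<Longrightarrow> root_unity n ^ k = 1 \<longleftrightarrow> n dvd k"
  using complex_root_unity_eq_1[of n k]
  by (simp add: root_unity_def exp_of_nat_mult[symmetric] mult_ac)

lemma root_unity_power_mod: "n > 0 \<Longrightarrow> root_unity n ^ (k mod n) = root_unity n ^ k"
proof -
  assume n: "n > 0"
  have "root_unity n ^ k = root_unity n ^ (n * (k div n) + k mod n)"
    by simp
  also have "\<dots> = (root_unity n ^ n) ^ (k div n) * root_unity n ^ (k mod n)"
    by (simp only: power_add power_mult)
  also have "root_unity n ^ n = 1"
    using n by (simp add: root_unity_power_eq_1)
  finally show ?thesis by simp
qed

locale coordinate_group =
  fixes r :: nat and N :: "nat \<Rightarrow> nat" and c :: "'g::{ab_group_add, finite} \<Rightarrow> nat \<Rightarrow> nat"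
  assumes coords: "cyclic_coordinates r N c"
begin

abbreviation X :: "'g \<Rightarrow> 'g \<Rightarrow> complex" where "X \<equiv> chi r N c"

lemma N_pos: "s < r \<Longrightarrow> N s > 0"
  using coords by (simp add: cyclic_coordinates_def)

lemma coord_PiE: "c g \<in> PiE {..<r} (\<lambda>s. {..<N s})"
  using coords by (auto simp: cyclic_coordinates_def bij_betw_def)

lemma coord_less: "s < r \<Longrightarrow> c g s < N s"
  using PiE_mem[OF coord_PiE[of g], of s] by simp

lemma coord_add: "s < r \<Longrightarrow> c (g + h) s = (c g s + c h s) mod N s"
  using coords by (simp add: cyclic_coordinates_def)

lemma coord_0: "s < r \<Longrightarrow> c 0 s = 0"
proof -
  assume s: "s < r"
  have "(c 0 s + c 0 s) mod N s = c 0 s mod N s"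
    using coord_add[OF s, of 0 0] coord_less[OF s, of 0] by simp
  then have "[c 0 s + c 0 s = 0 + c 0 s] (mod N s)"
    by (simp add: cong_def)
  then have "[c 0 s = 0] (mod N s)"
    by (simp only: cong_add_rcancel_nat)
  then show ?thesis
    using coord_less[OF s, of 0] by (simp add: cong_def)
qed

lemma chi_commute: "X z g = X g z"
  by (simp add: chi_def mult.commute)

lemma chi_add: "X z (g + h) = X z g * X z h"
  unfolding chi_def prod.distrib[symmetric]
proof (intro prod.cong refl)
  fix s assume "s \<in> {..<r}"
  then have s: "s < r" by simp
  have "root_unity (N s) ^ (c z s * c (g + h) s) = (root_unity (N s) ^ (c (g + h) s)) ^ c z s"
    by (metis power_mult mult.commute)
  also have "\<dots> = (root_unity (N s) ^ (c g s + c h s)) ^ c z s"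
    by (simp add: coord_add[OF s] root_unity_power_mod[OF N_pos[OF s]])
  also have "\<dots> = root_unity (N s) ^ (c z s * c g s) * root_unity (N s) ^ (c z s * c h s)"
    by (simp add: power_mult[symmetric] power_add[symmetric] algebra_simps)
  finally show "root_unity (N s) ^ (c z s * c (g + h) s)
      = root_unity (N s) ^ (c z s * c g s) * root_unity (N s) ^ (c z s * c h s)" .
qed

lemma chi_0_right: "X z 0 = 1"
  by (simp add: chi_def coord_0)

lemma chi_0_left: "X 0 g = 1"
  by (simp add: chi_def coord_0)

lemma norm_chi: "norm (X z g) = 1"
  by (simp add: chi_def root_unity_def prod_norm[symmetric] norm_power norm_exp_eq_Re)

lemma chi_nonzero: "X z g \<noteq> 0"
  using norm_chi[of z g] by auto

lemma chi_mult_uminus: "X z g * X z (- g) = 1"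
  using chi_add[of z g "- g"] by (simp add: chi_0_right)

lemma cnj_chi: "cnj (X z g) = X z (- g)"
proof -
  have "X z g * cnj (X z g) = X z g * X z (- g)"
    by (simp add: complex_norm_square[symmetric] norm_chi chi_mult_uminus)
  then show ?thesis
    using chi_nonzero by simp
qed

lemma chi_separates:
  assumes "g \<noteq> 0"
  shows "\<exists>z. X z g \<noteq> 1"
proof -
  have inj: "inj c" and surj: "range c = PiE {..<r} (\<lambda>s. {..<N s})"
    using coords by (auto simp: cyclic_coordinates_def bij_betw_def)
  have "\<exists>s<r. c g s \<noteq> 0"
  proof (rule ccontr)
    assume "\<not> ?thesis"
    then have "c g = c 0"
      by (intro PiE_ext[OF coord_PiE coord_PiE]) (simp add: coord_0)
    with inj assms show False by (auto dest: injD)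
  qed
  then obtain s where s: "s < r" "c g s \<noteq> 0" by blast
  \<comment> \<open>The unit vector at \<open>s\<close> isolates that coordinate of
    \<open>g\<close>. It is admissible because \<open>c g s \<noteq> 0\<close> forces
    \<open>N s > 1\<close>.\<close>
  have "(\<lambda>i\<in>{..<r}. if i = s then 1 else 0) \<in> range c"
    unfolding surj using N_pos coord_less[OF s(1), of g] s(2) by auto
  then obtain z where z: "c z = (\<lambda>i\<in>{..<r}. if i = s then 1 else 0)"
    by (metis imageE)
  have "X z g = (\<Prod>i<r. if i = s then root_unity (N s) ^ c g s else 1)"
    unfolding chi_def by (intro prod.cong) (auto simp: z)
  also have "\<dots> = root_unity (N s) ^ c g s"
    using s by simp
  finally have "X z g = root_unity (N s) ^ c g s" .
  moreover have "\<not> N s dvd c g s"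
    using s coord_less[OF s(1), of g] by (auto dest: dvd_imp_le)
  ultimately show ?thesis
    using root_unity_power_eq_1[OF N_pos[OF s(1)]] by metis
qed

text \<open>Orthogonality: shifting the summation index by \<open>w\<close> multiplies the sum by
  \<open>X w g\<close>, which can be chosen different from 1 when
  \<open>g \<noteq> 0\<close>.\<close>

lemma sum_chi: "(\<Sum>z\<in>UNIV. X z g) = (if g = 0 then of_nat (CARD('g)) else 0)"
proof (cases "g = 0")
  case False
  then obtain w where w: "X w g \<noteq> 1"
    using chi_separates by blast
  have "(\<Sum>z\<in>UNIV. X z g) = (\<Sum>z\<in>UNIV. X (w + z) g)"
    by (rule sum.reindex_bij_witness[of _ "\<lambda>z. w + z" "\<lambda>z. z - w"]) auto
  also have "\<dots> = X w g * (\<Sum>z\<in>UNIV. X z g)"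
    by (simp add: chi_commute[of _ g] chi_add sum_distrib_left)
  finally show ?thesis
    using w False by simp
qed (simp add: chi_0_right)

text \<open>Fourier inversion: weighting the transform by \<open>X z (- h)\<close> and summing over
  \<open>z\<close> recovers \<open>f h\<close> up to the order of the group.\<close>

lemma fourier_injective:
  assumes "\<And>z. (\<Sum>g\<in>UNIV. X z g * f g) = 0"
  shows "f h = 0"
proof -
  have "0 = (\<Sum>z\<in>UNIV. X z (- h) * (\<Sum>g\<in>UNIV. X z g * f g))"
    using assms by simp
  also have "\<dots> = (\<Sum>z\<in>UNIV. \<Sum>g\<in>UNIV. X z (g - h) * f g)"
    by (simp add: sum_distrib_left diff_conv_add_uminus chi_add mult_ac del: add_uminus_conv_diff)
  also have "\<dots> = (\<Sum>g\<in>UNIV. (\<Sum>z\<in>UNIV. X z (g - h)) * f g)"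
    by (subst sum.swap) (simp add: sum_distrib_right)
  also have "\<dots> = (\<Sum>g\<in>UNIV. if g = h then of_nat (CARD('g)) * f g else 0)"
    by (intro sum.cong) (auto simp: sum_chi)
  finally show ?thesis by simp
qed

lemma chi_set_reindex: "(\<Sum>h\<in>{h. h - g \<in> Y}. X z h) = X z g * chi_set r N c z Y"
proof -
  have "(\<Sum>h\<in>{h. h - g \<in> Y}. X z h) = (\<Sum>y\<in>Y. X z (g + y))"
    by (rule sum.reindex_bij_witness[of _ "\<lambda>y. g + y" "\<lambda>h. h - g"]) auto
  then show ?thesis
    by (simp add: chi_add chi_set_def sum_distrib_left)
qed

lemma chi_set_reindex_minus: "(\<Sum>h\<in>{h. g - h \<in> Y}. X z h) = X z g * cnj (chi_set r N c z Y)"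
proof -
  have "(\<Sum>h\<in>{h. g - h \<in> Y}. X z h) = (\<Sum>y\<in>Y. X z (g + - y))"
    by (rule sum.reindex_bij_witness[of _ "\<lambda>y. g + - y" "\<lambda>h. g - h"]) auto
  then show ?thesis
    by (simp only: chi_add chi_set_def sum_distrib_left cnj_chi cnj_sum)
qed

text \<open>Translation changes character sums only by factors of modulus 1. It serves to replace S
  by a set whose sums are real.\<close>

lemma chi_set_translate: "chi_set r N c z ((\<lambda>y. y - b) ` Y) = chi_set r N c z Y * X z (- b)"
proof -
  have "chi_set r N c z ((\<lambda>y. y - b) ` Y) = (\<Sum>y\<in>Y. X z (y + - b))"
    unfolding chi_set_def by (subst sum.reindex) auto
  then show ?thesis
    by (simp only: chi_add chi_set_def sum_distrib_right)
qed

lemma chi_set_0: "chi_set r N c 0 Y = of_nat (card Y)"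
  by (simp add: chi_set_def chi_0_left)

lemma chi_set_real:
  assumes "Y = uminus ` Y"
  shows "chi_set r N c z Y \<in> \<real>"
proof -
  have "cnj (chi_set r N c z Y) = (\<Sum>y\<in>Y. X z (- y))"
    by (simp add: chi_set_def cnj_chi)
  also have "\<dots> = chi_set r N c z (uminus ` Y)"
    unfolding chi_set_def by (subst sum.reindex) auto
  also have "\<dots> = chi_set r N c z Y"
    using assms by simp
  finally show ?thesis
    by (simp add: complex_is_Real_iff complex_eq_iff)
qed

section \<open>Rationality of character sums\<close>

text \<open>The indicator of the class is \<open>(1 + e * X z b) / 2\<close>, after which
  orthogonality evaluates the sum over all \<open>z\<close>.\<close>

lemma class_sum:
  assumes sign: "\<And>z. X z b = 1 \<or> X z b = -1" and e: "e = 1 \<or> e = -1"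
  shows "(\<Sum>z | X z b = e. chi_set r N c z Y)
    = of_nat (CARD('g)) / 2 * (\<Sum>y\<in>Y. of_bool (y = 0) + e * of_bool (b + y = 0))"
proof -
  have "(\<Sum>z | X z b = e. chi_set r N c z Y)
      = (\<Sum>z\<in>UNIV. if X z b = e then chi_set r N c z Y else 0)"
    by (simp add: sum.If_cases)
  also have "\<dots> = (\<Sum>z\<in>UNIV. \<Sum>y\<in>Y. 1 / 2 * (X z y + e * X z (b + y)))"
  proof (intro sum.cong refl)
    fix z
    have "(\<Sum>y\<in>Y. 1 / 2 * (X z y + e * X z (b + y))) = (1 + e * X z b) / 2 * chi_set r N c z Y"
      by (simp add: chi_set_def chi_add sum_distrib_left sum.distrib algebra_simps add_divide_distrib
          sum_divide_distrib)
    with sign[of z] e show "(if X z b = e then chi_set r N c z Y else 0)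
        = (\<Sum>y\<in>Y. 1 / 2 * (X z y + e * X z (b + y)))"
      by auto
  qed
  also have "\<dots> = (\<Sum>y\<in>Y. 1 / 2 * ((\<Sum>z\<in>UNIV. X z y) + e * (\<Sum>z\<in>UNIV. X z (b + y))))"
    by (subst sum.swap) (simp add: sum_distrib_left sum.distrib algebra_simps)
  also have "\<dots> = of_nat (CARD('g)) / 2 * (\<Sum>y\<in>Y. of_bool (y = 0) + e * of_bool (b + y = 0))"
    unfolding sum_distrib_left sum_chi by (intro sum.cong) (auto simp: algebra_simps)
  finally show ?thesis .
qed

lemma chi_set_rational:
  assumes sign: "\<And>z. X z b = 1 \<or> X z b = -1"
    and diff: "\<And>z z'. X z b = X z' b \<Longrightarrow>
      \<exists>k::int. chi_set r N c z Y - chi_set r N c z' Y = \<tau> * of_int k"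
  shows "chi_set r N c z Y \<in> \<rat>"
proof -
  let ?F = "\<lambda>z. chi_set r N c z Y"
  have sum_rat: "(\<Sum>z | X z b = e. ?F z) \<in> \<rat>" if "e = 1 \<or> e = -1" for e
    unfolding class_sum[OF sign that] using that by (auto intro!: Rats_mult Rats_sum Rats_add Rats_divide)
  show ?thesis
  proof (cases "\<tau> \<in> \<rat>")
    case True
    let ?C = "{w. X w b = X z b}"
    \<comment> \<open>Within the class all differences are rational multiples of a rational \<tau>,
      so a rational class sum makes each single value rational.\<close>
    have "?F z * of_nat (card ?C) = (\<Sum>w\<in>?C. ?F z - ?F w) + (\<Sum>w\<in>?C. ?F w)"
      by (simp add: sum_subtractf)
    also have "\<dots> \<in> \<rat>"
    proof (rule Rats_add, rule Rats_sum)
      show "?F z - ?F w \<in> \<rat>" if "w \<in> ?C" for w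
        using diff[of z w] that True by (auto intro!: Rats_mult)
      show "(\<Sum>w\<in>?C. ?F w) \<in> \<rat>"
        using sum_rat[OF sign] .
    qed
    finally have "?F z * of_nat (card ?C) / of_nat (card ?C) \<in> \<rat>"
      by (intro Rats_divide) auto
    moreover have "card ?C \<noteq> 0"
      by (subst card_eq_0_iff) auto
    then have "of_nat (card ?C) \<noteq> (0 :: complex)"
      by (simp only: of_nat_eq_0_iff not_False_eq_True)
    then have "?F z * of_nat (card ?C) / of_nat (card ?C) = ?F z"
      by (rule nonzero_mult_div_cancel_right)
    ultimately show ?thesis
      by (simp only:)
  next
    case irr: False
    \<comment> \<open>On the class \<open>X w b = 1\<close> the sum of \<open>?F 0 - ?F w\<close> is rational and an integer multiple of \<open>\<tau>\<close>,
      hence zero. By orthogonality this confines \<open>Y\<close> to \<open>{0, - b}\<close>.\<close>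
    let ?C = "{w. X w b = 1}"
    have "\<forall>w\<in>?C. \<exists>k::int. ?F 0 - ?F w = \<tau> * of_int k"
      using diff[of 0] by (simp add: chi_0_left)
    then obtain k :: "'g \<Rightarrow> int" where k: "\<And>w. w \<in> ?C \<Longrightarrow> ?F 0 - ?F w = \<tau> * of_int (k w)"
      by metis
    have "(\<Sum>w\<in>?C. ?F 0 - ?F w) = \<tau> * of_int (\<Sum>w\<in>?C. k w)"
      using k by (simp add: sum_distrib_left)
    moreover have "(\<Sum>w\<in>?C. ?F 0 - ?F w) \<in> \<rat>"
      unfolding sum_subtractf by (intro Rats_diff sum_rat) (auto simp: chi_set_0)
    ultimately have "\<tau> * of_int (\<Sum>w\<in>?C. k w) \<in> \<rat>" by simp
    with irr have "(\<Sum>w\<in>?C. k w) = 0"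
      by (metis Rats_divide Rats_of_int nonzero_mult_div_cancel_right of_int_eq_0_iff)
    with \<open>(\<Sum>w\<in>?C. ?F 0 - ?F w) = \<tau> * of_int (\<Sum>w\<in>?C. k w)\<close>
    have zero: "(\<Sum>w\<in>?C. ?F 0) - (\<Sum>w\<in>?C. ?F w) = 0"
      by (simp only: sum_subtractf of_int_0 mult_zero_right)
    \<comment> \<open>All character sums of \<open>{0}\<close> are 1, so \<open>class_sum\<close>
      applied to this set counts the class.\<close>
    have "(\<Sum>w\<in>?C. ?F 0) = (\<Sum>w\<in>?C. chi_set r N c w {0}) * of_nat (card Y)"
      by (simp add: chi_set_0) (simp add: chi_set_def chi_0_right)
    also have "\<dots> = of_nat (CARD('g)) / 2 * (\<Sum>y\<in>Y. 1 + of_bool (b = 0))"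
      by (subst class_sum[OF sign]) (auto simp: algebra_simps)
    finally have "of_nat (CARD('g)) / 2 * (\<Sum>y\<in>Y. 1 + of_bool (b = 0)
        - (of_bool (y = 0) + of_bool (b + y = 0))) = (0 :: complex)"
      using zero class_sum[OF sign, of 1] by (simp add: sum_subtractf algebra_simps)
    then have "(\<Sum>y\<in>Y. 1 + of_bool (b = 0) - (of_bool (y = 0) + of_bool (b + y = 0))) = (0 :: complex)"
      by simp
    moreover have of_real_bool: "complex_of_real (of_bool P) = of_bool P" for P
      by simp
    ultimately have "complex_of_real (\<Sum>y\<in>Y. 1 + of_bool (b = 0) - (of_bool (y = 0) + of_bool (b + y = 0))) = 0"
      by (simp only: of_real_sum of_real_diff of_real_add of_real_1 of_real_bool)
    then have "(\<Sum>y\<in>Y. 1 + of_bool (b = 0) - (of_bool (y = 0) + of_bool (b + y = 0))) = (0 :: real)"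
      by (simp only: of_real_eq_0_iff)
    \<comment> \<open>Every summand is nonnegative: \<open>y = 0\<close> and
      \<open>b + y = 0\<close> exclude each other if \<open>b \<noteq> 0\<close> and coincide if
      \<open>b = 0\<close>, where the leading term is 2. The sum was moved to the reals to use this
      order.\<close>
    then have "\<forall>y\<in>Y. 1 + of_bool (b = 0) - (of_bool (y = 0) + of_bool (b + y = 0)) = (0 :: real)"
      by (subst (asm) sum_nonneg_eq_0_iff) (auto simp: of_bool_def)
    then have Y: "y = 0 \<or> y = - b" if "y \<in> Y" for y
      using that by (auto simp: of_bool_def eq_neg_iff_add_eq_0 add.commute split: if_splits)
    have "X z (- b) \<in> \<rat>"
      using sign[of z] by (auto simp flip: cnj_chi)
    then show ?thesis
      unfolding chi_set_def using Y by (intro Rats_sum) (auto dest!: Y simp: chi_0_right)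
  qed
qed

end

section \<open>Eigenvectors and spectrum of the semi-Cayley graph\<close>

lemma UNIV_2_01: "(UNIV :: 2 set) = {0, 1}"
  using exhaust_2 by (auto simp: UNIV_2)

lemma layer_cases: "(i :: 2) = 0 \<or> i = 1"
  using UNIV_2_01 by blast

lemma sum_layers:
  "(\<Sum>v\<in>UNIV. f v) = (\<Sum>h\<in>UNIV. f (h, 0 :: 2) + f (h, 1) :: 'a :: comm_monoid_add)"
proof -
  have "(\<Sum>v\<in>UNIV. f v) = (\<Sum>h\<in>UNIV. \<Sum>i\<in>UNIV. f (h, i))"
    by (simp add: sum.cartesian_product)
  then show ?thesis
    by (simp add: UNIV_2_01)
qed

lemma semi_cayley_edge_iff:
  "{(g, 0), (h, 0)} \<in> semi_cayley R L S \<longleftrightarrow> h - g \<in> R \<or> g - h \<in> R"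
  "{(g, 1), (h, 1)} \<in> semi_cayley R L S \<longleftrightarrow> h - g \<in> L \<or> g - h \<in> L"
  "{(g, 0), (h, 1)} \<in> semi_cayley R L S \<longleftrightarrow> h - g \<in> S"
  "{(g, 1), (h, 0)} \<in> semi_cayley R L S \<longleftrightarrow> g - h \<in> S"
  by (auto simp: semi_cayley_def doubleton_eq_iff)

lemma adjacency_matrix_Ints: "adjacency_matrix E $ i $ j \<in> \<int>"
  by (simp add: adjacency_matrix_def)

context coordinate_group
begin

text \<open>The value 1 at a vanishing sum keeps the modulus 1 and the polar decomposition
  valid.\<close>

definition phase :: "'g set \<Rightarrow> 'g \<Rightarrow> complex" where
  "phase S z = (if chi_set r N c z S = 0 then 1 else sgn (chi_set r N c z S))"

lemma chi_set_phase: "chi_set r N c z S = of_real (norm (chi_set r N c z S)) * phase S z"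
  by (simp add: phase_def sgn_eq)

lemma norm_phase: "norm (phase S z) = 1"
  by (simp add: phase_def norm_sgn)

lemma phase_nonzero: "phase S z \<noteq> 0"
  using norm_phase[of S z] by auto

lemma phase_mult_cnj: "phase S z * cnj (phase S z) = 1"
  by (simp add: complex_norm_square[symmetric] norm_phase)

lemma phase_0: "phase S 0 = 1"
  by (simp add: phase_def chi_set_0 sgn_eq)

definition layer_vector :: "complex \<Rightarrow> complex \<Rightarrow> 'g \<Rightarrow> complex^('g \<times> 2)" where
  "layer_vector p q z = (\<chi> v. (if snd v = 0 then p else q) * X z (fst v))"

text \<open>For fixed \<open>z\<close> these vectors form an invariant space on which the adjacency
  matrix acts as a 2 by 2 matrix. From layer 1 the S-edges are traversed backwards, which negates
  the elements of S and so conjugates the character sum.\<close>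

lemma adjacency_layer_vector:
  assumes "R = uminus ` R"
  shows "adjacency_matrix (semi_cayley R R S) *v layer_vector p q z =
    layer_vector (p * chi_set r N c z R + q * chi_set r N c z S)
      (q * chi_set r N c z R + p * cnj (chi_set r N c z S)) z"
    (is "?A *v ?w = ?w'")
proof -
  have sym: "g - h \<in> R \<longleftrightarrow> h - g \<in> R" for g h
    using assms by (metis image_eqI minus_diff_eq)
  have out: "(\<Sum>h\<in>UNIV. of_bool (h - g \<in> Y) * (k * X z h)) = k * (X z g * chi_set r N c z Y)"
    for g k Y
    by (simp add: chi_set_reindex[symmetric] sum_distrib_left sum_of_bool_mult_eq)
  have inn: "(\<Sum>h\<in>UNIV. of_bool (g - h \<in> Y) * (k * X z h)) = k * (X z g * cnj (chi_set r N c z Y))"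
    for g k Y
    by (simp add: chi_set_reindex_minus[symmetric] sum_distrib_left sum_of_bool_mult_eq)
  have "(?A *v ?w) $ (g, i) = ?w' $ (g, i)" for g i
    using layer_cases[of i]
  proof
    assume i: "i = 0"
    have "(?A *v ?w) $ (g, i) = (\<Sum>h\<in>UNIV. of_bool (h - g \<in> R) * (p * X z h))
        + (\<Sum>h\<in>UNIV. of_bool (h - g \<in> S) * (q * X z h))"
      by (simp add: i matrix_vector_mult_def sum_layers adjacency_matrix_def semi_cayley_edge_iff
          layer_vector_def sym of_bool_def sum.distrib)
    then show ?thesis
      unfolding out by (simp add: i layer_vector_def algebra_simps)
  next
    assume i: "i = 1"
    have "(?A *v ?w) $ (g, i) = (\<Sum>h\<in>UNIV. of_bool (g - h \<in> S) * (p * X z h))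
        + (\<Sum>h\<in>UNIV. of_bool (h - g \<in> R) * (q * X z h))"
      by (simp add: i matrix_vector_mult_def sum_layers adjacency_matrix_def semi_cayley_edge_iff
          layer_vector_def sym of_bool_def sum.distrib)
    then show ?thesis
      unfolding out inn by (simp add: i layer_vector_def algebra_simps)
  qed
  then show ?thesis
    by (simp add: vec_eq_iff split_paired_all)
qed

definition eigval :: "'g set \<Rightarrow> 'g set \<Rightarrow> complex \<Rightarrow> 'g \<Rightarrow> complex" where
  "eigval R S e z = chi_set r N c z R + e * of_real (norm (chi_set r N c z S))"

lemma semi_cayley_eigenvector:
  assumes "R = uminus ` R" and "e = 1 \<or> e = -1"
  shows "adjacency_matrix (semi_cayley R R S) *v layer_vector (phase S z) e z
    = eigval R S e z *s layer_vector (phase S z) e z"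
proof -
  let ?s = "complex_of_real (norm (chi_set r N c z S))" and ?f = "phase S z"
  have "e * (?s * ?f) = e * ?s * ?f" "?f * cnj (?s * ?f) = e * ?s * e"
    using assms(2) phase_mult_cnj[of S z] by (auto simp: mult_ac)
  then have "?f * chi_set r N c z R + e * chi_set r N c z S = eigval R S e z * ?f"
    and "e * chi_set r N c z R + ?f * cnj (chi_set r N c z S) = eigval R S e z * e"
    unfolding eigval_def chi_set_phase[of z S, symmetric] by (simp_all add: algebra_simps)
  then show ?thesis
    unfolding adjacency_layer_vector[OF assms(1)]
    by (simp add: layer_vector_def vec_eq_iff mult_ac)
qed

lemma layer_vector_nonzero: "p \<noteq> 0 \<Longrightarrow> layer_vector p q z \<noteq> 0"
  by (auto simp: layer_vector_def vec_eq_iff chi_nonzero intro!: exI[of _ 0])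

text \<open>By symmetry of the matrix, an eigenvector for any other \<mu> would pair to zero with
  all the known eigenvectors. The two signs \<open>e\<close> separate the layers, and injectivity of
  the Fourier transform on each layer makes the vector vanish.\<close>

lemma semi_cayley_spectrum:
  assumes R: "R = uminus ` R"
    and "matrix_eigenvalue (adjacency_matrix (semi_cayley R R S)) \<mu>"
  obtains z e where "e = 1 \<or> e = -1" "\<mu> = eigval R S e z"
proof (rule ccontr)
  assume "\<not> thesis"
  then have neq: "\<mu> \<noteq> eigval R S e z" if "e = 1 \<or> e = -1" for e z
    using that \<open>\<And>e z. e = 1 \<or> e = -1 \<Longrightarrow> \<mu> = eigval R S e z \<Longrightarrow> thesis\<close> by blast
  let ?A = "adjacency_matrix (semi_cayley R R S)"
  obtain x where x: "x \<noteq> 0" "?A *v x = \<mu> *s x"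
    using assms(2) by (auto simp: matrix_eigenvalue_def)
  define y where "y i z = (\<Sum>g\<in>UNIV. X z g * x $ (g, i))" for i z
  have orth: "phase S z * y 0 z + e * y 1 z = 0" if e: "e = 1 \<or> e = -1" for e z
  proof -
    let ?w = "layer_vector (phase S z) e z"
    have "\<mu> * (\<Sum>i\<in>UNIV. ?w $ i * x $ i) = (\<Sum>i\<in>UNIV. ?w $ i * (?A *v x) $ i)"
      by (simp add: x(2) sum_distrib_left mult_ac)
    also have "\<dots> = eigval R S e z * (\<Sum>i\<in>UNIV. ?w $ i * x $ i)"
      unfolding sum_vector_matrix_mult adjacency_matrix_left semi_cayley_eigenvector[OF R e]
      by (simp add: sum_distrib_left mult_ac)
    finally have "(\<Sum>i\<in>UNIV. ?w $ i * x $ i) = 0"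
      using neq[OF e] by simp
    then show ?thesis
      by (simp add: sum_layers layer_vector_def y_def sum_distrib_left sum.distrib mult_ac)
  qed
  have "y 0 z = 0 \<and> y 1 z = 0" for z
    using orth[of 1 z] orth[of "-1" z] phase_nonzero[of S z]
    by (simp add: eq_neg_iff_add_eq_0[symmetric])
  then have "x $ (g, i) = 0" for g i
    using layer_cases[of i] fourier_injective[of "\<lambda>g. x $ (g, i)" g] by (auto simp: y_def)
  with x(1) show False
    by (simp add: vec_eq_iff split_paired_all)
qed

lemma eigval_integer:
  assumes "R = uminus ` R" and "e = 1 \<or> e = -1" and "eigval R S e z \<in> \<rat>"
  shows "eigval R S e z \<in> \<int>"
  using rational_eigenvalue_integer_matrix[OF adjacency_matrix_Ints
      semi_cayley_eigenvector[OF assms(1,2)] layer_vector_nonzero[OF phase_nonzero] assms(3)] .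

lemma rational_spectrum_imp_integral:
  assumes R: "R = uminus ` R"
    and rat: "\<And>z. chi_set r N c z R \<in> \<rat>" "\<And>z. norm (chi_set r N c z S) \<in> \<rat>"
  shows "integral_graph (semi_cayley R R S) \<and>
         (\<forall>z. chi_set r N c z R \<in> \<int> \<and> norm (chi_set r N c z S) \<in> \<int>)"
proof (intro conjI allI)
  have int: "eigval R S e z \<in> \<int>" if "e = 1 \<or> e = -1" for e z
    using that by (intro eigval_integer[OF R]) (auto simp: eigval_def intro!: Rats_add Rats_diff rat)
  then show "integral_graph (semi_cayley R R S)"
    unfolding integral_graph_def using semi_cayley_spectrum[OF R] by metis
  fix z
  \<comment> \<open>With an empty connecting set the character sum of R is itself an eigenvalue.
    Averaging the two eigenvalues belonging to S would only show that its double is an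
    integer.\<close>
  have "eigval R {} 1 z \<in> \<int>"
    using rat by (intro eigval_integer[OF R]) (auto simp: eigval_def chi_set_def)
  then show *: "chi_set r N c z R \<in> \<int>"
    by (simp add: eigval_def chi_set_def)
  have "complex_of_real (norm (chi_set r N c z S)) = eigval R S 1 z - chi_set r N c z R"
    by (simp add: eigval_def)
  also have "\<dots> \<in> \<int>"
    using * int by auto
  finally show "norm (chi_set r N c z S) \<in> \<int>"
    by (simp only: of_real_in_Ints_iff)
qed

section \<open>Consequences of revival for the character sums\<close>

text \<open>Dividing by the eigenvector's entry at the starting vertex isolates the ratio of its
  entries at the two vertices, a number of modulus 1.\<close>

lemma revival_phase:
  assumes R: "R = uminus ` R" and e: "e = 1 \<or> e = -1"
    and rev: "transition_matrix (semi_cayley R R S) t *v axis (g, i) 1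
      = \<alpha> *s axis (g, i) 1 + \<beta> *s axis (h, j) 1"
  shows "exp (\<i> * of_real t * eigval R S e z) = \<alpha> + \<beta> *
    ((if j = 0 then phase S z else e) / (if i = 0 then phase S z else e) * X z (h - g))"
proof -
  let ?k = "\<lambda>i :: 2. if i = 0 then phase S z else e"
  have k: "?k i \<noteq> 0"
    using e phase_nonzero by auto
  have "exp (\<i> * of_real t * eigval R S e z) * (?k i * X z g) = \<alpha> * (?k i * X z g) + \<beta> * (?k j * X z h)"
    using eigenvector_at_revival[OF semi_cayley_eigenvector[OF R e] rev] by (simp add: layer_vector_def)
  moreover have "X z h = X z (h - g) * X z g"
    using chi_add[of z "h - g" g] by simp
  ultimately have "exp (\<i> * of_real t * eigval R S e z) * (?k i * X z g)
      = (\<alpha> + \<beta> * (?k j / ?k i * X z (h - g))) * (?k i * X z g)"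
    using k by (simp add: distrib_right)
  then show ?thesis
    using k chi_nonzero[of z g] by simp
qed

text \<open>Here the ratio \<open>X z a\<close> does not depend on \<open>e\<close>, so both
  eigenvalues have the same exponential and \<bar>\<chi>(S)\<bar> is a multiple of
  \<open>pi / t\<close>. The sums over R are compared within the two classes
  \<open>X z a = 1\<close> and \<open>X z a = -1\<close>.\<close>

lemma same_layer_rational:
  assumes R: "R = uminus ` R" and nz: "\<alpha> \<noteq> 0" "\<beta> \<noteq> 0" "(norm \<alpha>)\<^sup>2 + (norm \<beta>)\<^sup>2 = 1" and a: "a \<noteq> 0"
    and ph: "\<And>z e. e = 1 \<or> e = -1 \<Longrightarrow>
      exp (\<i> * of_real t * eigval R S e z) = \<alpha> + \<beta> * X z a"
  shows "chi_set r N c z R \<in> \<rat> \<and> norm (chi_set r N c z S) \<in> \<rat>"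
proof -
  define \<rho> where "\<rho> z = Re (chi_set r N c z R)" for z
  define s where "s z = norm (chi_set r N c z S)" for z
  have \<rho>: "chi_set r N c z R = of_real (\<rho> z)" for z
    using chi_set_real[OF R] by (simp add: \<rho>_def)
  have exp_plus: "exp (\<i> * of_real t * of_real (\<rho> z + s z)) = \<alpha> + \<beta> * X z a"
    and exp_minus: "exp (\<i> * of_real t * of_real (\<rho> z - s z)) = \<alpha> + \<beta> * X z a" for z
    using ph[of 1 z] ph[of "-1" z] by (simp_all add: eigval_def \<rho> s_def)
  have unit: "norm (\<alpha> + \<beta> * X z a) = 1" for z
    unfolding exp_plus[symmetric] by (simp add: norm_exp_eq_Re)
  have sign: "X z a = 1 \<or> X z a = -1" for z
    using unit_combination_cases[OF nz _ unit norm_chi] unit[of 0] by (simp add: chi_0_left)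
  obtain w where w: "X w a \<noteq> 1"
    using chi_separates[OF a] by blast
  \<comment> \<open>At time 0 every exponential would be 1, but the right-hand side differs between
    \<open>w\<close> and 0.\<close>
  have "t \<noteq> 0"
  proof
    assume "t = 0"
    then have "\<alpha> + \<beta> * X w a = \<alpha> + \<beta> * X 0 a"
      using exp_plus[of w] exp_plus[of 0] by simp
    with w nz(2) show False by (simp add: chi_0_left)
  qed
  have s: "\<exists>k::int. s z = pi / t * of_int k" for z
  proof -
    obtain k :: int where "(\<rho> z + s z) - (\<rho> z - s z) = 2 * (pi / t * of_int k)"
      using exp_imaginary_eq[OF trans[OF exp_plus exp_minus[symmetric]] \<open>t \<noteq> 0\<close>] by blast
    then have "2 * s z = 2 * (pi / t * of_int k)" by simp
    then have "s z = pi / t * of_int k" by linarith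
    then show ?thesis ..
  qed
  have diff: "\<exists>k::int. chi_set r N c z R - chi_set r N c z' R = of_real (pi / t) * of_int k"
    if "X z a = X z' a" for z z'
  proof -
    have "exp (\<i> * of_real t * of_real (\<rho> z + s z)) = exp (\<i> * of_real t * of_real (\<rho> z' + s z'))"
      by (simp only: exp_plus that)
    then obtain k :: int where k: "(\<rho> z + s z) - (\<rho> z' + s z') = 2 * (pi / t * of_int k)"
      using exp_imaginary_eq[OF _ \<open>t \<noteq> 0\<close>]
      by blast
    obtain l l' :: int where "s z = pi / t * of_int l" "s z' = pi / t * of_int l'"
      using s by blast
    with k have "\<rho> z - \<rho> z' = pi / t * of_int (2 * k - l + l')"
      by (simp add: algebra_simps)
    then have "complex_of_real (\<rho> z - \<rho> z') = of_real (pi / t) * of_int (2 * k - l + l')"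
      by (simp only: of_real_mult of_real_of_int_eq)
    then show ?thesis
      unfolding \<rho> of_real_diff by blast
  qed
  have "s z \<in> \<rat>"
  proof (cases "S = {}")
    case False
    \<comment> \<open>At the trivial character the multiple of \<open>pi / t\<close> is the positive
      integer \<open>card S\<close>, which makes \<open>pi / t\<close> rational.\<close>
    obtain k :: int where k: "s 0 = pi / t * of_int k" using s by blast
    have "s 0 = of_nat (card S)" "card S > 0"
      using False by (simp_all add: s_def chi_set_0 card_gt_0_iff)
    with k have "k \<noteq> 0" "of_nat (card S) = pi / t * of_int k"
      by auto
    then have "pi / t = of_nat (card S) / of_int k"
      by (simp only: eq_divide_eq) simp
    then have "pi / t \<in> \<rat>"
      by simp
    moreover obtain l :: int where "s z = pi / t * of_int l" using s by blast
    ultimately show "s z \<in> \<rat>"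
      by (simp only: Rats_mult Rats_of_int)
  qed (simp add: s_def chi_set_def)
  then show ?thesis
    using chi_set_rational[OF sign diff] by (simp add: s_def)
qed

text \<open>Here the ratio is \<open>e * x z\<close>. Once \<open>x z\<close> is a sign, it is
  absorbed into \<sigma>, the character sum of a translate of S. Then
  \<open>\<rho> + \<sigma>\<close> and \<open>\<rho> - \<sigma>\<close> have exponentials
  independent of \<open>z\<close>, so all characters form a single class.\<close>

lemma distinct_layers_rational:
  assumes R: "R = uminus ` R" and nz: "\<alpha> \<noteq> 0" "\<beta> \<noteq> 0" "(norm \<alpha>)\<^sup>2 + (norm \<beta>)\<^sup>2 = 1"
    and x: "\<And>z. norm (x z) = 1" "x 0 = 1"
    and shift: "\<And>z. x z = 1 \<or> x z = -1 \<Longrightarrow>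
      chi_set r N c z ((\<lambda>y. y - b) ` S) = x z * of_real (norm (chi_set r N c z S))"
    and ph: "\<And>z e. e = 1 \<or> e = -1 \<Longrightarrow>
      exp (\<i> * of_real t * eigval R S e z) = \<alpha> + \<beta> * (e * x z)"
  shows "chi_set r N c z R \<in> \<rat> \<and> norm (chi_set r N c z S) \<in> \<rat>"
proof -
  let ?S = "(\<lambda>y. y - b) ` S"
  define \<rho> where "\<rho> z = Re (chi_set r N c z R)" for z
  define \<sigma> where "\<sigma> z = Re (x z) * norm (chi_set r N c z S)" for z
  have \<rho>: "chi_set r N c z R = of_real (\<rho> z)" for z
    using chi_set_real[OF R] by (simp add: \<rho>_def)
  have unit: "norm (\<alpha> + \<beta> * x z) = 1" for z
    using ph[of 1 z] norm_exp_i_times[of "t * (\<rho> z + norm (chi_set r N c z S))"]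
    by (simp add: eigval_def \<rho> mult.assoc)
  have sign: "x z = 1 \<or> x z = -1" for z
    using unit_combination_cases[OF nz _ unit x(1)] unit[of 0] x(2) by simp
  have \<sigma>: "chi_set r N c z ?S = of_real (\<sigma> z)" for z
    using sign[of z] shift[of z] by (auto simp: \<sigma>_def)
  \<comment> \<open>If \<open>x z = -1\<close>, the two choices of \<open>e\<close> exchange their
    roles.\<close>
  have exp_plus: "exp (\<i> * of_real t * of_real (\<rho> z + \<sigma> z)) = \<alpha> + \<beta>"
    and exp_minus: "exp (\<i> * of_real t * of_real (\<rho> z - \<sigma> z)) = \<alpha> - \<beta>" for z
    using sign[of z] ph[of 1 z] ph[of "-1" z] by (auto simp: eigval_def \<rho> \<sigma>_def)
  have "t \<noteq> 0"
  proof
    assume "t = 0"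
    then have "\<alpha> + \<beta> = \<alpha> - \<beta>"
      using exp_plus[of 0] exp_minus[of 0] by simp
    with nz(2) show False by (simp add: eq_neg_iff_add_eq_0)
  qed
  have diff: "\<exists>k l::int. \<rho> z - \<rho> z' = pi / t * of_int k \<and> \<sigma> z - \<sigma> z' = pi / t * of_int l" for z z'
  proof -
    obtain k :: int where k: "(\<rho> z + \<sigma> z) - (\<rho> z' + \<sigma> z') = 2 * (pi / t * of_int k)"
      using exp_imaginary_eq[OF trans[OF exp_plus exp_plus[symmetric]] \<open>t \<noteq> 0\<close>] by blast
    obtain l :: int where l: "(\<rho> z - \<sigma> z) - (\<rho> z' - \<sigma> z') = 2 * (pi / t * of_int l)"
      using exp_imaginary_eq[OF trans[OF exp_minus exp_minus[symmetric]] \<open>t \<noteq> 0\<close>] by blast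
    have "\<rho> z - \<rho> z' = pi / t * of_int (k + l)" "\<sigma> z - \<sigma> z' = pi / t * of_int (k - l)"
      using k l unfolding of_int_add of_int_diff distrib_left right_diff_distrib by linarith+
    then show ?thesis by blast
  qed
  have scale: "\<exists>k::int. complex_of_real u - of_real u' = of_real (pi / t) * of_int k"
    if "\<exists>k::int. u - u' = pi / t * of_int k" for u u'
    using that by (metis of_real_diff of_real_mult of_real_of_int_eq)
  \<comment> \<open>Taking \<open>b = 0\<close> puts every character into the class of value
    1.\<close>
  have "chi_set r N c z R \<in> \<rat>"
    by (rule chi_set_rational[of 0 _ "of_real (pi / t)"])
      (simp add: chi_0_right, unfold \<rho>, rule scale, use diff in blast)
  moreover have "chi_set r N c z ?S \<in> \<rat>"
    by (rule chi_set_rational[of 0 _ "of_real (pi / t)"])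
      (simp add: chi_0_right, unfold \<sigma>, rule scale, use diff in blast)
  moreover have "complex_of_real (norm (chi_set r N c z S)) = x z * chi_set r N c z ?S"
    using shift[OF sign, of z] sign[of z] by auto
  moreover have "x z \<in> \<rat>"
    using sign[of z] by auto
  ultimately show ?thesis
    by (metis Rats_mult Rats_complex_of_real_iff)
qed

end

theorem theorem4p1:
  fixes R S :: "('g::{ab_group_add, finite}) set"
    and r :: nat and N :: "nat \<Rightarrow> nat" and c :: "'g \<Rightarrow> nat \<Rightarrow> nat"
    and \<alpha> \<beta> :: complex and u v :: "'g \<times> 2"
  assumes "cyclic_coordinates r N c"
    and "R = uminus ` R" and "0 \<notin> R"
    and "\<alpha> \<noteq> 0" and "\<beta> \<noteq> 0"
    and "revival (semi_cayley R R S) \<alpha> \<beta> u v"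
  shows "integral_graph (semi_cayley R R S) \<and>
         (\<forall>z. chi_set r N c z R \<in> \<int> \<and> norm (chi_set r N c z S) \<in> \<int>)"
proof -
  interpret coordinate_group r N c
    by unfold_locales (rule assms(1))
  obtain g i h j where uv: "u = (g, i)" "v = (h, j)"
    by (meson surj_pair)
  obtain t where ne: "(g, i) \<noteq> (h, j)" and ab: "(norm \<alpha>)\<^sup>2 + (norm \<beta>)\<^sup>2 = 1"
    and rev: "transition_matrix (semi_cayley R R S) t *v axis (g, i) 1
      = \<alpha> *s axis (g, i) 1 + \<beta> *s axis (h, j) 1"
    using assms(6) by (auto simp: revival_def uv)
  note ph = revival_phase[OF assms(2) _ rev]
  have "chi_set r N c z R \<in> \<rat> \<and> norm (chi_set r N c z S) \<in> \<rat>" for z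
  proof -
    consider "i = j" | "i = 0" "j = 1" | "i = 1" "j = 0"
      using layer_cases[of i] layer_cases[of j] by auto
    then show ?thesis
    proof cases
      case 1
      show ?thesis
      proof (rule same_layer_rational[OF assms(2,4,5) ab, of "h - g"])
        show "h - g \<noteq> 0" using ne 1 by simp
        show "exp (\<i> * of_real t * eigval R S e z) = \<alpha> + \<beta> * X z (h - g)"
          if "e = 1 \<or> e = -1" for z e
          using ph[OF that] that phase_nonzero[of S z] by (auto simp: 1)
      qed
    next
      case 2
      have inv: "1 / phase S z = cnj (phase S z)" for z
        using phase_mult_cnj[of S z] phase_nonzero[of S z] by (simp add: divide_eq_eq mult.commute)
      show ?thesis
      proof (rule distinct_layers_rational[OF assms(2,4,5) ab,
            of "\<lambda>z. X z (h - g) * cnj (phase S z)" "h - g"])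
        fix z
        assume "X z (h - g) * cnj (phase S z) = 1 \<or> X z (h - g) * cnj (phase S z) = -1"
        \<comment> \<open>The translate of S produces the conjugate of the ratio, which agrees with
          the ratio because that is real.\<close>
        then have "cnj (X z (h - g) * cnj (phase S z)) = X z (h - g) * cnj (phase S z)"
          by (elim disjE) (simp_all only: complex_cnj_one complex_cnj_minus)
        then have "X z (- (h - g)) * phase S z = X z (h - g) * cnj (phase S z)"
          by (simp only: complex_cnj_mult complex_cnj_cnj cnj_chi)
        then show "chi_set r N c z ((\<lambda>y. y - (h - g)) ` S)
            = X z (h - g) * cnj (phase S z) * of_real (norm (chi_set r N c z S))"
          unfolding chi_set_translate by (subst chi_set_phase) (simp add: mult_ac)
      next
        show "exp (\<i> * of_real t * eigval R S e z) = \<alpha> + \<beta> * (e * (X z (h - g) * cnj (phase S z)))"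
          if "e = 1 \<or> e = -1" for z e
          using ph[OF that, of z] by (simp add: 2 inv[symmetric])
      qed (simp_all add: norm_mult norm_chi norm_phase phase_0 chi_0_left)
    next
      case 3
      show ?thesis
      \<comment> \<open>In the reverse direction the phase enters unconjugated, so S is translated
        by the opposite element.\<close>
      proof (rule distinct_layers_rational[OF assms(2,4,5) ab,
            of "\<lambda>z. X z (h - g) * phase S z" "- (h - g)"])
        show "chi_set r N c z ((\<lambda>y. y - - (h - g)) ` S)
            = X z (h - g) * phase S z * of_real (norm (chi_set r N c z S))" for z
          unfolding chi_set_translate by (subst chi_set_phase) (simp add: mult_ac)
        show "exp (\<i> * of_real t * eigval R S e z) = \<alpha> + \<beta> * (e * (X z (h - g) * phase S z))"
          if "e = 1 \<or> e = -1" for z e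
          using ph[OF that, of z] that by (auto simp: 3 mult_ac)
      qed (simp_all add: norm_mult norm_chi norm_phase phase_0 chi_0_left)
    qed
  qed
  then show ?thesis
    by (intro rational_spectrum_imp_integral[OF assms(2)]) auto
qed

end
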